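(* Let $\lambda$ be a locally finite atomless Borel measure on a Polish space $X$. There is a unique probability measure $\mathbb P^X_\lambda$ on $\mathcal F(X)$ such that for every open $U\subseteq X$ of finite $\lambda$-measure, if the random variable $F$ has law $\mathbb P^X_\lambda$, then the random variable $|F\cap U|$ follows the Poisson law of parameter $\lambda(U)$.
   Context: A Borel measure on a Polish space is locally finite if every point has an open neighborhood of finite measure. $\mathcal F(X)$ is the set of closed subsets of $X$, endowed with the Effros $\sigma$-algebra, i.e. the $\sigma$-algebra generated by the sets $\{F\in\mathcal F(X): F\cap U\neq\emptyset\}$ for $U\subseteq X$ open; it is a standard Borel space and, for $U$ open, $F\mapsto |F\cap U|\in\mathbb N\cup\{\infty\}$ is Borel. The Poisson law of parameter $t\in(0,\infty)$ is the probability measure on $\mathbb N$ giving mass $e^{-t}t^k/k!$ to $k$; the Poisson law of parameter $0$ is the Dirac measure at $0$. *)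

theory Defs
  imports "HOL-Probability.Probability"
begin

definition locally_finite :: "'a::topological_space measure \<Rightarrow> bool" where
  "locally_finite M \<longleftrightarrow> (\<forall>x. \<exists>U. open U \<and> x \<in> U \<and> emeasure M U < \<infinity>)"

(* Atomless in the sense of descriptive set theory: points are null. *)
definition atomless :: "'a measure \<Rightarrow> bool" where
  "atomless M \<longleftrightarrow> (\<forall>x. emeasure M {x} = 0)"

definition effros :: "'a::topological_space set measure" where
  "effros = sigma {F. closed F} {{F. closed F \<and> F \<inter> U \<noteq> {}} |U. open U}"

definition ecard :: "'a set \<Rightarrow> enat" where
  "ecard A = (if finite A then enat (card A) else \<infinity>)"

(* The library constant poisson_pmf is only specified for positive rates. *)
definition poisson_law :: "real \<Rightarrow> nat pmf" where
  "poisson_law t = (if t = 0 then return_pmf 0 else poisson_pmf t)"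

(* The Poisson law is pushed forward along the inclusion of the naturals into enat, so that it
   can be the law of a random variable that is allowed to take the value infinity. The event
   sigma-algebra on the countable type enat is the full power set. *)
definition has_poisson_law :: "'b measure \<Rightarrow> ('b \<Rightarrow> enat) \<Rightarrow> real \<Rightarrow> bool" where
  "has_poisson_law P N t \<longleftrightarrow>
     N \<in> measurable P (count_space UNIV) \<and>
     distr P (count_space UNIV) N = measure_pmf (map_pmf enat (poisson_law t))"

end

theory Submission
  imports Defs
begin

text \<open>
  Uniqueness: the sets of closed sets missing a given open set of finite measure form a
  \<open>\<pi>\<close>-system generating the Effros \<open>\<sigma>\<close>-algebra, and a Poisson law gives the void
  probabilities \<open>exp (- \<lambda> U)\<close> on it.

  Existence: cut the space into countably many disjoint Borel pieces of finite measure, throw into the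
  \<open>n\<close>-th piece an independent Poisson number of independent points with the normalised
  restriction of \<open>\<lambda>\<close> as law, and take the set of all these points. Conditioning on the numbers
  of points, the generating function of the number of points in \<open>U\<close> comes out as
  \<open>exp (- \<lambda> U * (1 - s))\<close>, which identifies the Poisson law. The points are almost surely
  distinct because \<open>\<lambda>\<close> is atomless, and the set is almost surely closed because each set of a
  countable open cover contains almost surely finitely many points.
\<close>

section \<open>The Effros \<open>\<sigma>\<close>-algebra\<close>

lemma enat_le_ecard_iff: "enat k \<le> ecard A \<longleftrightarrow> (\<exists>T\<subseteq>A. finite T \<and> card T = k)"
proof
  assume "enat k \<le> ecard A"
  then show "\<exists>T\<subseteq>A. finite T \<and> card T = k"
    using infinite_arbitrarily_large[of A k] obtain_subset_with_card_n[of k A]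
    by (cases "finite A") (auto simp: ecard_def)
next
  assume "\<exists>T\<subseteq>A. finite T \<and> card T = k"
  then show "enat k \<le> ecard A"
    by (auto simp: ecard_def card_mono)
qed

text \<open>The type \<open>enat\<close> is countable, so singletons suffice:
  \<open>{enat k}\<close> is a difference of two consecutive tails, and \<open>{\<infinity>}\<close>
  is what remains after removing all finite values.\<close>

lemma measurable_enat_countI:
  assumes "\<And>k. {x\<in>space M. enat k \<le> f x} \<in> sets M"
  shows "f \<in> measurable M (count_space UNIV)"
proof (rule measurable_count_space_eq2_countable[THEN iffD2, rule_format])
  have *: "f -` {enat k} \<inter> space M = {x\<in>space M. enat k \<le> f x} - {x\<in>space M. enat (Suc k) \<le> f x}" for k
    by (auto simp: Suc_ile_eq)
  have fin: "f -` {enat k} \<inter> space M \<in> sets M" for k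
    unfolding * using assms by blast
  have **: "f -` {\<infinity>} \<inter> space M = space M - (\<Union>k. f -` {enat k} \<inter> space M)"
    by (auto intro: enat.exhaust)
  have "f -` {a} \<inter> space M \<in> sets M" for a
  proof (cases a)
    case (enat k) then show ?thesis using fin by simp
  next
    case infinity
    show ?thesis unfolding infinity ** using fin by blast
  qed
  then show "f \<in> space M \<rightarrow> UNIV \<and> (\<forall>a\<in>UNIV. f -` {a} \<inter> space M \<in> sets M)" by blast
qed

text \<open>A countable index type has only countably many finite subsets, so having at least
  \<open>k\<close> elements is a countable union of finite intersections of the given
  events.\<close>

lemma measurable_ecard_Collect:
  fixes P :: "'b \<Rightarrow> 'i::countable \<Rightarrow> bool"
  assumes "\<And>i. {x\<in>space M. P x i} \<in> sets M"
  shows "(\<lambda>x. ecard {i. P x i}) \<in> measurable M (count_space UNIV)"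
proof (rule measurable_enat_countI)
  fix k
  have "{x\<in>space M. enat k \<le> ecard {i. P x i}}
      = (\<Union>T\<in>{T. finite T \<and> card T = k}. {x\<in>space M. \<forall>i\<in>T. P x i})"
    unfolding enat_le_ecard_iff by auto
  also have "\<dots> \<in> sets M"
  proof (rule sets.countable_UN'')
    show "countable {T::'i set. finite T \<and> card T = k}"
      by (rule countable_subset[OF _ countable_Collect_finite]) auto
  qed (use assms in \<open>auto intro!: sets.sets_Collect_finite_All\<close>)
  finally show "{x\<in>space M. enat k \<le> ecard {i. P x i}} \<in> sets M" .
qed

lemma space_effros [simp]: "space effros = {F. closed F}"
  and sets_effros: "sets effros = sigma_sets {F. closed F} {{F. closed F \<and> F \<inter> U \<noteq> {}} |U. open U}"
  unfolding effros_def by (auto intro!: space_measure_of sets_measure_of)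

lemma hit_in_effros: "open U \<Longrightarrow> {F. closed F \<and> F \<inter> U \<noteq> {}} \<in> sets effros"
  unfolding sets_effros by (rule sigma_sets.Basic) auto

text \<open>An open set meets \<open>closure (S x)\<close> exactly when it meets \<open>S x\<close>,
  so the generators of the Effros structure pull back to the assumed events even if
  \<open>S x\<close> is not closed.\<close>

lemma measurable_closure_effros:
  fixes S :: "'b \<Rightarrow> 'a::topological_space set"
  assumes "\<And>U. open U \<Longrightarrow> {x\<in>space M. S x \<inter> U \<noteq> {}} \<in> sets M"
  shows "(\<lambda>x. closure (S x)) \<in> measurable M effros"
  unfolding effros_def
proof (rule measurable_measure_of)
  fix y :: "'a set set" assume "y \<in> {{F. closed F \<and> F \<inter> U \<noteq> {}} |U. open U}"
  then obtain U where U: "open U" "y = {F. closed F \<and> F \<inter> U \<noteq> {}}" by auto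
  then have "(\<lambda>x. closure (S x)) -` y \<inter> space M = {x\<in>space M. S x \<inter> U \<noteq> {}}"
    using open_Int_closure_eq_empty[OF U(1)] by (auto simp: Int_commute)
  then show "(\<lambda>x. closure (S x)) -` y \<inter> space M \<in> sets M" using assms U(1) by simp
qed auto

text \<open>Around each point of \<open>T\<close>, take a basic set inside the ball of half the
  distance to the other points; two such balls are disjoint by the triangle inequality.\<close>

lemma finite_disjoint_basis:
  fixes T :: "'a::metric_space set"
  assumes "topological_basis \<B>" "finite T" "open U" "T \<subseteq> U"
  obtains f where "\<And>x. x \<in> T \<Longrightarrow> f x \<in> \<B> \<and> x \<in> f x \<and> f x \<subseteq> U"
    "disjoint_family_on f T"
proof -
  obtain d where d: "\<And>x. d x > 0" "\<And>x y. y \<in> T \<Longrightarrow> y \<noteq> x \<Longrightarrow> d x \<le> dist x y"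
    using finite_set_avoid[OF assms(2)] by metis
  have "\<exists>B. x \<in> T \<longrightarrow> B \<in> \<B> \<and> x \<in> B \<and> B \<subseteq> U \<inter> ball x (d x / 2)" for x
  proof (cases "x \<in> T")
    case True
    then have "open (U \<inter> ball x (d x / 2))" "x \<in> U \<inter> ball x (d x / 2)"
      using assms(3,4) d(1)[of x] by auto
    then show ?thesis using topological_basisE[OF assms(1)] by metis
  qed simp
  then obtain f where f: "\<And>x. x \<in> T \<Longrightarrow> f x \<in> \<B> \<and> x \<in> f x \<and> f x \<subseteq> U \<inter> ball x (d x / 2)"
    by metis
  have "disjoint_family_on f T"
    unfolding disjoint_family_on_def
  proof safe
    fix x y z assume *: "x \<in> T" "y \<in> T" "x \<noteq> y" "z \<in> f x" "z \<in> f y"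
    then have "dist x z < d x / 2" "dist y z < d y / 2" using f by fastforce+
    then have "dist x y < d x / 2 + d y / 2" using dist_triangle2[of x y z] by linarith
    then show "z \<in> {}" using d(2)[of x y] d(2)[of y x] * by (simp add: dist_commute)
  qed
  with f show ?thesis by (intro that[of f]) blast+
qed

text \<open>A set has at least \<open>k\<close> points in \<open>U\<close> iff it hits
  \<open>U \<inter> B\<close> for all \<open>B\<close> in some disjoint family of \<open>k\<close>
  basic sets. A countable basis has countably many such families, and each hitting condition is an
  Effros generator.\<close>

lemma measurable_ecard_effros:
  fixes U :: "'a::{metric_space, second_countable_topology} set"
  assumes U: "open U"
  shows "(\<lambda>F. ecard (F \<inter> U)) \<in> measurable effros (count_space UNIV)"
proof (rule measurable_enat_countI)
  fix k
  obtain \<B> :: "'a set set" where \<B>: "countable \<B>" "topological_basis \<B>"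
    using ex_countable_basis by blast
  define \<T> where "\<T> = {T. T \<subseteq> \<B> \<and> finite T \<and> card T = k \<and> disjoint T}"
  have "countable \<T>"
    by (rule countable_subset[OF _ countable_Collect_finite_subset[OF \<B>(1)]]) (auto simp: \<T>_def)
  have "enat k \<le> ecard (F \<inter> U) \<longleftrightarrow> (\<exists>T\<in>\<T>. \<forall>B\<in>T. F \<inter> (U \<inter> B) \<noteq> {})" for F
  proof
    assume "enat k \<le> ecard (F \<inter> U)"
    then obtain S where S: "S \<subseteq> F \<inter> U" "finite S" "card S = k"
      unfolding enat_le_ecard_iff by auto
    then obtain f where f: "\<And>x. x \<in> S \<Longrightarrow> f x \<in> \<B> \<and> x \<in> f x \<and> f x \<subseteq> U" "disjoint_family_on f S"
      using finite_disjoint_basis[OF \<B>(2) S(2) U] by auto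
    \<comment> \<open>The basic sets are disjoint and nonempty, hence distinct, so the family has
      exactly \<open>k\<close> members.\<close>
    have "inj_on f S"
      unfolding inj_on_def using f by (metis disjoint_family_onD disjoint_iff)
    then have "f ` S \<in> \<T>"
      using S f by (auto simp: \<T>_def card_image disjoint_family_on_disjoint_image)
    moreover have "\<forall>B\<in>f ` S. F \<inter> (U \<inter> B) \<noteq> {}"
      using S f by blast
    ultimately show "\<exists>T\<in>\<T>. \<forall>B\<in>T. F \<inter> (U \<inter> B) \<noteq> {}" by blast
  next
    assume "\<exists>T\<in>\<T>. \<forall>B\<in>T. F \<inter> (U \<inter> B) \<noteq> {}"
    then obtain T where T: "T \<in> \<T>" "\<forall>B\<in>T. F \<inter> (U \<inter> B) \<noteq> {}" by blast
    then obtain g where g: "\<And>B. B \<in> T \<Longrightarrow> g B \<in> F \<inter> (U \<inter> B)"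
      unfolding ex_in_conv[symmetric] by metis
    \<comment> \<open>Conversely, points picked from disjoint sets are distinct.\<close>
    have "inj_on g T"
      using g T(1) unfolding \<T>_def inj_on_def disjoint_def by (auto, metis IntE disjoint_iff)+
    then show "enat k \<le> ecard (F \<inter> U)"
      unfolding enat_le_ecard_iff using g T(1)
      by (intro exI[of _ "g ` T"]) (auto simp: \<T>_def card_image)
  qed
  then have "{F\<in>space effros. enat k \<le> ecard (F \<inter> U)}
      = (\<Union>T\<in>\<T>. {F\<in>space effros. \<forall>B\<in>T. F \<in> {F. closed F \<and> F \<inter> (U \<inter> B) \<noteq> {}}})"
    by auto
  also have "\<dots> \<in> sets effros"
  proof (rule sets.countable_UN''[OF \<open>countable \<T>\<close>])
    fix T assume T: "T \<in> \<T>"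
    have "{F. closed F \<and> F \<inter> (U \<inter> B) \<noteq> {}} \<in> sets effros" if "B \<in> T" for B
      using that T U \<B>(2) by (intro hit_in_effros open_Int) (auto simp: \<T>_def topological_basis_open)
    then show "{F\<in>space effros. \<forall>B\<in>T. F \<in> {F. closed F \<and> F \<inter> (U \<inter> B) \<noteq> {}}} \<in> sets effros"
      using T by (intro sets.sets_Collect_finite_All) (auto simp: \<T>_def Collect_conj_eq Int_def[symmetric])
  qed
  finally show "{F\<in>space effros. enat k \<le> ecard (F \<inter> U)} \<in> sets effros" .
qed

section \<open>Void events of finite-measure open sets and uniqueness\<close>

lemma locally_finite_countable_cover:
  fixes M :: "'a::second_countable_topology measure"
  assumes "locally_finite M"
  obtains V :: "nat \<Rightarrow> 'a set"
  where "\<And>n. open (V n)" "\<And>n. emeasure M (V n) < \<infinity>" "(\<Union>n. V n) = UNIV"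
proof -
  obtain \<F> where F: "\<F> \<subseteq> {U. open U \<and> emeasure M U < \<infinity>}" "countable \<F>"
    "\<Union>\<F> = \<Union>{U. open U \<and> emeasure M U < \<infinity>}"
    by (rule Lindelof[of "{U. open U \<and> emeasure M U < \<infinity>}"]) auto
  have *: "\<Union>\<F> = UNIV"
    using assms unfolding F(3) locally_finite_def by blast
  then have ne: "\<F> \<noteq> {}" by auto
  show ?thesis
  proof
    show "open (from_nat_into \<F> n)" "emeasure M (from_nat_into \<F> n) < \<infinity>" for n
      using F(1) from_nat_into[OF ne, of n] by auto
    show "(\<Union>n. from_nat_into \<F> n) = UNIV"
      using * range_from_nat_into[OF ne F(2)] by simp
  qed
qed

text \<open>Hitting \<open>U\<close> means failing to miss some \<open>U \<inter> V n\<close>, where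
  the \<open>V n\<close> form a countable open cover by sets of finite measure. Thus the void events
  on which the Poisson condition says something already generate everything.\<close>

lemma sets_effros_miss:
  fixes M :: "'a::second_countable_topology measure"
  assumes M: "sets M = sets borel" and "locally_finite M"
  shows "sets effros = sigma_sets {F. closed F}
           {{F. closed F \<and> F \<inter> U = {}} |U::'a set. open U \<and> emeasure M U < \<infinity>}"
    (is "_ = sigma_sets ?\<Omega> ?E")
proof
  obtain V :: "nat \<Rightarrow> 'a set" where V: "\<And>n. open (V n)" "\<And>n. emeasure M (V n) < \<infinity>" "(\<Union>n. V n) = UNIV"
    using locally_finite_countable_cover[OF assms(2)] by blast
  have hit: "{F. closed F \<and> F \<inter> U \<noteq> {}} \<in> sigma_sets ?\<Omega> ?E" if "open U" for U
  proof -
    have "{F. closed F \<and> F \<inter> U \<noteq> {}} = (\<Union>n. ?\<Omega> - {F. closed F \<and> F \<inter> (U \<inter> V n) = {}})"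
    proof -
      have "F \<inter> U = {} \<longleftrightarrow> (\<forall>n. F \<inter> (U \<inter> V n) = {})" for F
      proof -
        have *: "F \<inter> U = (\<Union>n. F \<inter> (U \<inter> V n))"
          unfolding Int_UN_distrib[symmetric] V(3) by simp
        then show ?thesis by (subst *) auto
      qed
      then show ?thesis by auto
    qed
    also have "\<dots> \<in> sigma_sets ?\<Omega> ?E"
    proof (intro sigma_sets.Union sigma_sets.Compl sigma_sets.Basic)
      fix n
      have "emeasure M (U \<inter> V n) \<le> emeasure M (V n)"
        using V(1) M by (intro emeasure_mono) auto
      also note V(2)
      finally show "{F. closed F \<and> F \<inter> (U \<inter> V n) = {}} \<in> ?E"
        using V(1)[of n] that by (intro CollectI exI[of _ "U \<inter> V n"] conjI refl open_Int)
    qed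
    finally show ?thesis .
  qed
  show "sets effros \<subseteq> sigma_sets ?\<Omega> ?E"
    unfolding sets_effros
    by (intro sigma_sets_mono subsetI, elim CollectE exE conjE) (simp only: hit)
  show "sigma_sets ?\<Omega> ?E \<subseteq> sets effros"
  proof -
    have "{F. closed F \<and> F \<inter> U = {}} \<in> sets effros" if "open U" for U :: "'a set"
    proof -
      have "{F. closed F \<and> F \<inter> U = {}} = space effros - {F. closed F \<and> F \<inter> U \<noteq> {}}"
        by auto
      then show ?thesis using hit_in_effros[OF that] by (simp only: sets.compl_sets)
    qed
    then have "?E \<subseteq> sets effros" by auto
    then show ?thesis
      using sets.sigma_sets_subset[of ?E effros] by simp
  qed
qed

text \<open>Missing \<open>U\<close> and missing \<open>V\<close> amounts to missing
  \<open>U \<union> V\<close>, which again has finite measure; so the void events form a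
  \<pi>-system and Dynkin's theorem applies.\<close>

lemma effros_measure_eqI:
  fixes M :: "'a::second_countable_topology measure"
  assumes M: "sets M = sets borel" "locally_finite M"
    and P: "prob_space P" "sets P = sets effros"
    and Q: "prob_space Q" "sets Q = sets effros"
    and eq: "\<And>U. open U \<Longrightarrow> emeasure M U < \<infinity> \<Longrightarrow>
      emeasure P {F. closed F \<and> F \<inter> U = {}} = emeasure Q {F. closed F \<and> F \<inter> U = {}}"
  shows "P = Q"
proof (rule measure_eqI_generator_eq)
  let ?E = "{{F. closed F \<and> F \<inter> U = {}} |U::'a set. open U \<and> emeasure M U < \<infinity>}"
  show "Int_stable ?E"
  proof (rule Int_stableI)
    fix a b assume "a \<in> ?E" "b \<in> ?E"
    then obtain U V where *: "open U" "emeasure M U < \<infinity>" "a = {F. closed F \<and> F \<inter> U = {}}"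
      "open V" "emeasure M V < \<infinity>" "b = {F. closed F \<and> F \<inter> V = {}}" by auto
    have "emeasure M (U \<union> V) \<le> emeasure M U + emeasure M V"
      using M * by (intro emeasure_subadditive) auto
    also have "\<dots> < \<infinity>" using * by simp
    finally show "a \<inter> b \<in> ?E"
      using * by (intro CollectI exI[of _ "U \<union> V"]) auto
  qed
  show "?E \<subseteq> Pow {F. closed F}" by auto
  show "sets P = sigma_sets {F. closed F} ?E" "sets Q = sigma_sets {F. closed F} ?E"
    using P Q sets_effros_miss[OF M] by auto
  show "\<And>X. X \<in> ?E \<Longrightarrow> emeasure P X = emeasure Q X" using eq by auto
  \<comment> \<open>The whole space is the void event of the empty set, so a constant sequence
    exhausts it.\<close>
  show "range (\<lambda>_::nat. {F::'a set. closed F}) \<subseteq> ?E"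
    by (auto intro!: exI[of _ "{}"])
  show "emeasure P {F. closed F} \<noteq> \<infinity>"
    using finite_measure.emeasure_finite[OF prob_space.finite_measure[OF P(1)]] by simp
qed auto

section \<open>Poisson laws and generating functions\<close>

lemma pmf_poisson_law: "0 \<le> t \<Longrightarrow> pmf (poisson_law t) k = t ^ k / fact k * exp (- t)"
  by (cases "t = 0"; cases k) (auto simp: poisson_law_def)

text \<open>Uniqueness sees the Poisson law only through this void probability.\<close>

lemma has_poisson_law_void:
  assumes "has_poisson_law P N t" "0 \<le> t"
  shows "emeasure P {x\<in>space P. N x = 0} = ennreal (exp (- t))"
proof -
  have N: "N \<in> measurable P (count_space UNIV)"
    and d: "distr P (count_space UNIV) N = measure_pmf (map_pmf enat (poisson_law t))"
    using assms(1) by (auto simp: has_poisson_law_def)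
  have "emeasure P {x\<in>space P. N x = 0} = emeasure (distr P (count_space UNIV) N) {0}"
    using N by (subst emeasure_distr) (auto intro!: arg_cong[where f="emeasure P"])
  also have "\<dots> = ennreal (pmf (map_pmf enat (poisson_law t)) (enat 0))"
    unfolding d by (simp add: emeasure_pmf_single zero_enat_def)
  also have "\<dots> = ennreal (exp (- t))"
    using assms(2) by (subst pmf_map_inj') (auto simp: inj_def pmf_poisson_law)
  finally show ?thesis .
qed

lemma ecard_eq_0_iff [simp]: "ecard A = 0 \<longleftrightarrow> A = {}"
  by (auto simp: ecard_def zero_enat_def)

section \<open>Identification of laws by generating functions\<close>

text \<open>Strong induction: once the lower coefficients vanish, dividing by \<open>s ^ n\<close>
  leaves a power series with constant term \<open>c n\<close> that is zero on
  \<open>{0<..<1}\<close>. Its limit from the right at 0 is therefore both \<open>c n\<close> and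
  0.\<close>

lemma powser_sums_zero_imp_zero:
  fixes c :: "nat \<Rightarrow> real"
  assumes c: "\<And>s. 0 < s \<Longrightarrow> s < 1 \<Longrightarrow> (\<lambda>k. c k * s ^ k) sums 0"
  shows "c n = 0"
proof (induction n rule: less_induct)
  case (less n)
  define f where "f x = (\<Sum>i. c (i + n) * x ^ i)" for x :: real
  have shift: "(\<lambda>i. c (i + n) * s ^ i) sums 0" if s: "0 < s" "s < 1" for s
  proof -
    have "(\<lambda>i. c (i + n) * s ^ (i + n)) sums (0 - (\<Sum>i<n. c i * s ^ i))"
      using c[OF s] sums_iff_shift[of "\<lambda>i. c i * s ^ i" n] by simp
    then have "(\<lambda>i. c (i + n) * s ^ (i + n) / s ^ n) sums (0 / s ^ n)"
      using less by (intro sums_divide) simp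
    then show ?thesis using s by (simp add: power_add)
  qed
  have "(f \<longlongrightarrow> c (0 + n)) (at 0)"
  proof (rule powser_limit_0[where a = "\<lambda>i. c (i + n)" and s = "1/2"])
    \<comment> \<open>Convergence at the single point 1/2 gives convergence on the disc of that
      radius, negative arguments included.\<close>
    fix x :: real assume "norm x < 1/2"
    moreover have "summable (\<lambda>i. c (i + n) * (1/2) ^ i)"
      using shift[of "1/2"] by (simp add: sums_iff)
    ultimately have "summable (\<lambda>i. c (i + n) * x ^ i)"
      using powser_inside[of "\<lambda>i. c (i + n)" "1/2" x] by simp
    then show "(\<lambda>i. c (i + n) * x ^ i) sums f x"
      unfolding f_def by (rule summable_sums)
  qed simp
  then have right: "(f \<longlongrightarrow> c n) (at_right 0)"
    unfolding filterlim_at_split[of f] by simp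
  have "eventually (\<lambda>s. f s = 0) (at_right 0)"
    unfolding eventually_at_right_field
    using shift[THEN sums_unique] by (intro exI[of _ 1]) (simp add: f_def)
  then have "(f \<longlongrightarrow> 0) (at_right 0)"
    by (rule tendsto_eventually)
  then show ?case
    by (rule tendsto_unique[OF trivial_limit_at_right_real right])
qed

text \<open>The value at \<open>\<infinity>\<close> is the limit of \<open>s ^ k\<close>, which is 0
  for \<open>0 \<le> s < 1\<close>.\<close>

definition epower :: "real \<Rightarrow> enat \<Rightarrow> real" where
  "epower s n = (case n of enat k \<Rightarrow> s ^ k | \<infinity> \<Rightarrow> 0)"

lemma epower_enat [simp]: "epower s (enat k) = s ^ k"
  and epower_infinity [simp]: "epower s \<infinity> = 0"
  by (simp_all add: epower_def)

lemma poisson_pgf_sums: "(\<lambda>k. t ^ k / fact k * exp (- t) * s ^ k) sums exp (- (t * (1 - s)))"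
  for s t :: real
proof -
  have "(\<lambda>k. exp (- t) * ((t * s) ^ k /\<^sub>R fact k)) sums (exp (- t) * exp (t * s))"
    by (intro sums_mult exp_converges)
  also have "exp (- t) * exp (t * s) = exp (- (t * (1 - s)))"
    by (simp add: exp_add[symmetric] algebra_simps)
  finally show ?thesis by (simp add: power_mult_distrib field_simps)
qed

text \<open>A probability measure on \<open>enat\<close> is determined by its generating function on
  \<open>{0<..<1}\<close>; excluding 1 makes \<open>s\<close> to the power \<open>\<infinity>\<close> vanish.\<close>

lemma has_poisson_law_pgfI:
  assumes P: "prob_space P" and N [measurable]: "N \<in> measurable P (count_space UNIV)" and t: "0 \<le> t"
    and pgf: "\<And>s. 0 < s \<Longrightarrow> s < 1 \<Longrightarrow>
      (\<integral>\<^sup>+x. ennreal (epower s (N x)) \<partial>P) = ennreal (exp (- (t * (1 - s))))"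
  shows "has_poisson_law P N t"
proof -
  define Q where "Q = distr P (count_space UNIV) N"
  define R where "R = measure_pmf (map_pmf enat (poisson_law t))"
  interpret P: prob_space P by fact
  interpret Q: prob_space Q unfolding Q_def by (rule P.prob_space_distr) fact
  interpret R: prob_space R unfolding R_def by (rule measure_pmf.prob_space_axioms)
  have [simp]: "sets Q = UNIV" "space Q = UNIV" "sets R = UNIV" "space R = UNIV"
    by (auto simp: Q_def R_def)
  have law_sums: "(\<lambda>k. measure Q {enat k} * s ^ k) sums exp (- (t * (1 - s)))" if s: "0 < s" "s < 1" for s
  proof -
    \<comment> \<open>The series ranges over finite values only; at \<open>n = \<infinity>\<close>
      both sides are 0.\<close>
    have single: "ennreal (epower s n) = (\<Sum>k. ennreal (s ^ k) * indicator {enat k} n)" for n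
    proof (cases n)
      case (enat j)
      have "(\<Sum>k. ennreal (s ^ k) * indicator {enat k} n) = (\<Sum>k\<in>{j}. ennreal (s ^ k) * indicator {enat k} n)"
        by (rule suminf_finite) (auto simp: enat)
      then show ?thesis by (simp add: enat)
    qed simp
    have "ennreal (exp (- (t * (1 - s)))) = (\<integral>\<^sup>+n. ennreal (epower s n) \<partial>Q)"
      unfolding Q_def by (subst nn_integral_distr) (auto simp: pgf[OF s])
    also have "\<dots> = (\<Sum>k. \<integral>\<^sup>+n. ennreal (s ^ k) * indicator {enat k} n \<partial>Q)"
      unfolding single by (rule nn_integral_suminf) (auto simp: measurable_def)
    also have "\<dots> = (\<Sum>k. ennreal (measure Q {enat k} * s ^ k))"
      using s by (subst nn_integral_cmult_indicator)
        (auto simp: Q.emeasure_eq_measure ennreal_mult' mult.commute)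
    finally have "(\<lambda>k. ennreal (measure Q {enat k} * s ^ k)) sums ennreal (exp (- (t * (1 - s))))"
      by (simp add: sums_iff)
    then show ?thesis using s by (subst (asm) sums_ennreal) auto
  qed
  have "(\<lambda>k. (measure Q {enat k} - t ^ k / fact k * exp (- t)) * s ^ k) sums 0"
    if "0 < s" "s < 1" for s
    using sums_diff[OF law_sums[OF that] poisson_pgf_sums[of t s]] by (simp add: left_diff_distrib)
  then have "measure Q {enat k} - t ^ k / fact k * exp (- t) = 0" for k
    by (rule powser_sums_zero_imp_zero)
  moreover have "measure R {enat k} = t ^ k / fact k * exp (- t)" for k
    unfolding R_def using t
    by (subst measure_pmf_single, subst pmf_map_inj') (auto simp: inj_def pmf_poisson_law)
  ultimately have fin: "emeasure Q {enat k} = emeasure R {enat k}" for k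
    by (simp add: Q.emeasure_eq_measure R.emeasure_eq_measure)
  have "emeasure S (range enat) = (\<Sum>k. emeasure S {enat k})" if "sets S = UNIV" for S
    using that suminf_emeasure[of "\<lambda>k. {enat k}" S]
    by (simp add: disjoint_family_on_def UNION_singleton_eq_range)
  then have "emeasure Q (range enat) = emeasure R (range enat)"
    using fin by simp
  moreover have "{\<infinity>} = UNIV - range enat"
    by (auto intro: enat.exhaust)
  \<comment> \<open>Both measures have total mass 1 and agree on the finite values, so the remaining
    mass at \<open>\<infinity>\<close> agrees too.\<close>
  ultimately have inf: "emeasure Q {\<infinity>} = emeasure R {\<infinity>}"
    using emeasure_compl[of "range enat" Q] emeasure_compl[of "range enat" R]
      Q.emeasure_space_1 R.emeasure_space_1 by simp
  have "Q = R"
  proof (rule measure_eqI_countable)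
    show "emeasure Q {a} = emeasure R {a}" for a
      using fin inf by (cases a) auto
  qed auto
  then show ?thesis
    using N by (simp add: has_poisson_law_def Q_def R_def)
qed

text \<open>A finite subset of an increasing union lies in almost all of its stages. Hence the
  stages are eventually the whole union if that is finite; otherwise their cardinalities tend to
  infinity and the powers tend to 0.\<close>

lemma power_card_LIMSEQ_epower:
  assumes s: "0 \<le> s" "s < 1" and fin: "\<And>m. finite (A m)" and mono: "incseq A"
  shows "(\<lambda>m. s ^ card (A m)) \<longlonglongrightarrow> epower s (ecard (\<Union>m. A m))"
proof -
  have ev: "eventually (\<lambda>m. T \<subseteq> A m) sequentially" if "finite T" "T \<subseteq> (\<Union>m. A m)" for T
    using that
  proof (induction T)
    case (insert x T)
    then obtain k where k: "x \<in> A k" by auto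
    have "eventually (\<lambda>m. k \<le> m) sequentially" by (rule eventually_ge_at_top)
    then have "eventually (\<lambda>m. x \<in> A m) sequentially"
      by eventually_elim (use k incseqD[OF mono] in blast)
    then show ?case using insert by (auto elim: eventually_elim2)
  qed simp
  show ?thesis
  proof (cases "finite (\<Union>m. A m)")
    case True
    have "eventually (\<lambda>m. s ^ card (A m) = s ^ card (\<Union>m. A m)) sequentially"
      using ev[OF True subset_refl]
    proof eventually_elim
      case (elim m)
      then have "A m = (\<Union>m. A m)" by blast
      then show ?case by simp
    qed
    then show ?thesis
      using True by (simp add: ecard_def tendsto_eventually)
  next
    case False
    have "filterlim (\<lambda>m. card (A m)) at_top sequentially"
      unfolding filterlim_at_top
    proof
      fix k
      obtain T where T: "finite T" "card T = k" "T \<subseteq> (\<Union>m. A m)"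
        using infinite_arbitrarily_large[OF False, of k] by blast
      show "eventually (\<lambda>m. k \<le> card (A m)) sequentially"
        using ev[OF T(1,3)] by eventually_elim (use T(2) card_mono[OF fin] in blast)
    qed
    moreover have "(\<lambda>n. s ^ n) \<longlonglongrightarrow> 0"
      using s by (intro LIMSEQ_realpow_zero) auto
    ultimately have "(\<lambda>m. s ^ card (A m)) \<longlonglongrightarrow> 0"
      by (rule filterlim_compose[rotated])
    then show ?thesis using False by (simp add: ecard_def)
  qed
qed

lemma nn_integral_power_poisson_law:
  assumes "0 \<le> t" "0 \<le> r"
  shows "(\<integral>\<^sup>+k. ennreal (r ^ k) \<partial>measure_pmf (poisson_law t)) = ennreal (exp (- (t * (1 - r))))"
proof -
  have "(\<integral>\<^sup>+k. ennreal (r ^ k) \<partial>measure_pmf (poisson_law t))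
      = (\<Sum>k. ennreal (t ^ k / fact k * exp (- t) * r ^ k))"
    unfolding nn_integral_measure_pmf nn_integral_count_space_nat
    using assms by (simp only: pmf_poisson_law) (subst ennreal_mult[symmetric], auto)
  also have "\<dots> = ennreal (exp (- (t * (1 - r))))"
    using assms poisson_pgf_sums[of t r] by (intro suminf_ennreal_eq) auto
  finally show ?thesis .
qed

lemma has_poisson_law_AE_finite:
  assumes "has_poisson_law P N t"
  shows "AE x in P. N x \<noteq> \<infinity>"
proof -
  have N: "N \<in> measurable P (count_space UNIV)"
    and d: "distr P (count_space UNIV) N = measure_pmf (map_pmf enat (poisson_law t))"
    using assms by (auto simp: has_poisson_law_def)
  have "AE n in distr P (count_space UNIV) N. n \<noteq> \<infinity>"
    unfolding d by (auto simp: AE_measure_pmf_iff)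
  then show ?thesis by (rule AE_distrD[OF N])
qed

section \<open>Product measures\<close>

text \<open>The integrand depends on the coordinates in \<open>J\<close> only, so the integral
  passes to the finite product, where independence factors it.\<close>

lemma nn_integral_PiM_prod_finite:
  fixes M :: "'i \<Rightarrow> 'a measure"
  assumes M: "\<And>i. prob_space (M i)" and J: "finite J"
    and f: "\<And>i. i \<in> J \<Longrightarrow> f i \<in> borel_measurable (M i)"
  shows "(\<integral>\<^sup>+\<omega>. (\<Prod>i\<in>J. f i (\<omega> i)) \<partial>PiM UNIV M) = (\<Prod>i\<in>J. integral\<^sup>N (M i) (f i))"
proof -
  interpret product_prob_space M UNIV
    by (rule product_prob_spaceI) (rule M)
  have [measurable]: "(\<lambda>x. \<Prod>i\<in>J. f i (x i)) \<in> borel_measurable (PiM J M)"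
  proof (rule borel_measurable_prod_ennreal)
    fix i assume "i \<in> J"
    then show "(\<lambda>x. f i (x i)) \<in> borel_measurable (PiM J M)"
      by (rule measurable_compose[OF measurable_component_singleton]) (rule f[OF \<open>i \<in> J\<close>])
  qed
  have "(\<Prod>i\<in>J. integral\<^sup>N (M i) (f i)) = (\<integral>\<^sup>+x. (\<Prod>i\<in>J. f i (x i)) \<partial>PiM J M)"
    by (rule product_nn_integral_prod[symmetric]) (use J f in auto)
  also have "\<dots> = (\<integral>\<^sup>+x. (\<Prod>i\<in>J. f i (x i)) \<partial>distr (PiM UNIV M) (PiM J M) (\<lambda>x. restrict x J))"
    using distr_PiM_restrict_finite[OF J] by simp
  also have "\<dots> = (\<integral>\<^sup>+\<omega>. (\<Prod>i\<in>J. f i (\<omega> i)) \<partial>PiM UNIV M)"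
  proof (subst nn_integral_distr)
    show "(\<lambda>x. restrict x J) \<in> measurable (PiM UNIV M) (PiM J M)"
      by (rule measurable_restrict_subset) simp
  qed (auto intro!: nn_integral_cong)
  finally show ?thesis ..
qed

text \<open>Two distinct coordinates have the product measure as joint law, and the diagonal is null
  by Fubini because its slices are singletons.\<close>

lemma AE_PiM_coordinates_neq:
  fixes M :: "'i \<Rightarrow> 'a::{second_countable_topology, t2_space} measure"
  assumes M: "\<And>i. prob_space (M i)" "\<And>i. sets (M i) = sets borel"
    and "a \<noteq> b" "atomless (M a)"
  shows "AE \<omega> in PiM UNIV M. \<omega> a \<noteq> \<omega> b"
proof -
  interpret PP: product_prob_space M UNIV
    by (rule product_prob_spaceI) (rule M)
  interpret A: prob_space "M a" by (rule M)
  interpret B: prob_space "M b" by (rule M)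
  interpret BA: pair_sigma_finite "M b" "M a" ..
  note M(2)[measurable_cong]
  \<comment> \<open>The pair is ordered with \<open>\<omega> b\<close> first so that the inner null
    set is taken with respect to the atomless \<open>M a\<close>.\<close>
  have joint: "distr (PiM UNIV M) (M b \<Otimes>\<^sub>M M a) (\<lambda>\<omega>. (\<omega> b, \<omega> a)) = M b \<Otimes>\<^sub>M M a"
  proof (rule pair_measure_eqI[symmetric])
    fix X Y assume XY: "X \<in> sets (M b)" "Y \<in> sets (M a)"
    have "emeasure (distr (PiM UNIV M) (M b \<Otimes>\<^sub>M M a) (\<lambda>\<omega>. (\<omega> b, \<omega> a))) (X \<times> Y)
        = emeasure (PiM UNIV M) {\<omega>\<in>space (PiM UNIV M). \<forall>i\<in>{a, b}. \<omega> i \<in> (if i = a then Y else X)}"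
      using XY assms(3) by (subst emeasure_distr) (auto intro!: arg_cong[where f="emeasure _"])
    also have "\<dots> = emeasure (M b) X * emeasure (M a) Y"
      using XY assms(3) by (subst PP.emeasure_PiM_Collect) (auto simp: mult.commute)
    finally show "emeasure (M b) X * emeasure (M a) Y
      = emeasure (distr (PiM UNIV M) (M b \<Otimes>\<^sub>M M a) (\<lambda>\<omega>. (\<omega> b, \<omega> a))) (X \<times> Y)" ..
  qed (auto intro: prob_space_imp_sigma_finite M(1))
  have "AE p in M b \<Otimes>\<^sub>M M a. snd p \<noteq> fst p"
  proof (rule BA.AE_pair_measure)
    show "{x \<in> space (M b \<Otimes>\<^sub>M M a). snd x \<noteq> fst x} \<in> sets (M b \<Otimes>\<^sub>M M a)"
      by measurable
    have "AE y in M a. y \<noteq> x" for x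
      using assms(4) M(2)[of a] by (intro AE_I[of _ _ "{x}"]) (auto simp: atomless_def)
    then show "AE x in M b. AE y in M a. snd (x, y) \<noteq> fst (x, y)" by simp
  qed
  then have "AE p in distr (PiM UNIV M) (M b \<Otimes>\<^sub>M M a) (\<lambda>\<omega>. (\<omega> b, \<omega> a)). snd p \<noteq> fst p"
    unfolding joint .
  then have "AE \<omega> in PiM UNIV M. snd (\<omega> b, \<omega> a) \<noteq> fst (\<omega> b, \<omega> a)"
    by (rule AE_distrD[rotated]) measurable
  then show ?thesis by simp
qed

section \<open>Superposition of finite Poisson processes\<close>

text \<open>Piece \<open>n\<close> has total mass \<open>t n\<close> and normalised law
  \<open>\<mu> n\<close>. For a piece of mass 0 the law is an arbitrary probability measure, hence
  the guard on atomlessness.\<close>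

locale poisson_superposition =
  fixes t :: "nat \<Rightarrow> real" and \<mu> :: "nat \<Rightarrow> 'a::polish_space measure"
  assumes t_nonneg: "0 \<le> t n"
    and prob_\<mu>: "prob_space (\<mu> n)"
    and sets_\<mu>: "sets (\<mu> n) = sets borel"
    and atomless_\<mu>: "0 < t n \<Longrightarrow> atomless (\<mu> n)"
begin

definition counts :: "(nat \<Rightarrow> nat) measure" where
  "counts = PiM UNIV (\<lambda>n. measure_pmf (poisson_law (t n)))"

text \<open>Index \<open>(n, i)\<close> is the \<open>i\<close>-th candidate point of piece
  \<open>n\<close>. Infinitely many candidates are drawn per piece so that they can be independent
  of the counts.\<close>

definition points :: "(nat \<times> nat \<Rightarrow> 'a) measure" where
  "points = PiM UNIV (\<lambda>p. \<mu> (fst p))"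

definition sample :: "((nat \<Rightarrow> nat) \<times> (nat \<times> nat \<Rightarrow> 'a)) measure" where
  "sample = counts \<Otimes>\<^sub>M points"

text \<open>Of the sequence of points attached to piece \<open>n\<close>, only the first \<open>fst \<omega> n\<close> are
  present.\<close>

definition active :: "(nat \<Rightarrow> nat) \<times> (nat \<times> nat \<Rightarrow> 'a) \<Rightarrow> 'a set \<Rightarrow> (nat \<times> nat) set" where
  "active \<omega> A = {p. snd p < fst \<omega> (fst p) \<and> snd \<omega> p \<in> A}"

definition support :: "(nat \<Rightarrow> nat) \<times> (nat \<times> nat \<Rightarrow> 'a) \<Rightarrow> 'a set" where
  "support \<omega> = snd \<omega> ` active \<omega> UNIV"

section \<open>Measurability on the sample space\<close>

lemma prob_space_counts: "prob_space counts"
  unfolding counts_def by (rule prob_space_PiM) (rule measure_pmf.prob_space_axioms)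

lemma prob_space_points: "prob_space points"
  unfolding points_def by (rule prob_space_PiM) (rule prob_\<mu>)

lemma prob_space_sample: "prob_space sample"
  unfolding sample_def by (rule prob_space_pair[OF prob_space_counts prob_space_points])

lemma measurable_count [measurable]: "(\<lambda>\<omega>. fst \<omega> n) \<in> measurable sample (count_space UNIV)"
proof -
  have "(\<lambda>N. N n) \<in> measurable counts (measure_pmf (poisson_law (t n)))"
    unfolding counts_def by (rule measurable_component_singleton) simp
  then have "(\<lambda>N. N n) \<in> measurable counts (count_space UNIV)"
    by simp
  then show ?thesis
    unfolding sample_def by (rule measurable_compose[OF measurable_fst])
qed

lemma measurable_point [measurable]: "(\<lambda>\<omega>. snd \<omega> p) \<in> borel_measurable sample"
proof -
  have "(\<lambda>Y. Y p) \<in> measurable points (\<mu> (fst p))"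
    unfolding points_def by (rule measurable_component_singleton) simp
  then have "(\<lambda>Y. Y p) \<in> borel_measurable points"
    using measurable_cong_sets[OF refl sets_\<mu>] by blast
  then show ?thesis
    unfolding sample_def by (rule measurable_compose[OF measurable_snd])
qed

lemma sets_active:
  assumes [measurable]: "A \<in> sets borel"
  shows "{\<omega>\<in>space sample. p \<in> active \<omega> A} \<in> sets sample"
  unfolding active_def mem_Collect_eq by measurable

lemma measurable_ecard_active [measurable]:
  assumes "A \<in> sets borel"
  shows "(\<lambda>\<omega>. ecard (active \<omega> A)) \<in> measurable sample (count_space UNIV)"
  using measurable_ecard_Collect[of sample "\<lambda>\<omega> p. p \<in> active \<omega> A"] sets_active[OF assms] by simp

text \<open>The support need not be closed on a null set; taking closures makes the random set take
  values in the closed sets without changing which open sets it hits.\<close>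

lemma measurable_closure_support: "(\<lambda>\<omega>. closure (support \<omega>)) \<in> measurable sample effros"
proof (rule measurable_closure_effros)
  fix U :: "'a set" assume U: "open U"
  have "{\<omega>\<in>space sample. support \<omega> \<inter> U \<noteq> {}} = (\<Union>p. {\<omega>\<in>space sample. p \<in> active \<omega> U})"
    by (auto simp: support_def active_def)
  also have "\<dots> \<in> sets sample"
    using sets_active[of U] U by (intro sets.countable_UN) auto
  finally show "{\<omega>\<in>space sample. support \<omega> \<inter> U \<noteq> {}} \<in> sets sample" .
qed

section \<open>The number of active points in a Borel set\<close>

text \<open>Restricting to the first \<open>m\<close> pieces keeps the active set finite. Given the
  counts \<open>N\<close>, independence of the points yields the product of the
  \<open>r n ^ N n\<close>; averaging over independent Poisson counts turns each factor into
  \<open>exp (- (t n * (1 - r n)))\<close>.\<close>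

lemma partial_pgf:
  assumes A [measurable]: "A \<in> sets borel" and s: "0 < s" "s < 1"
  shows "(\<lambda>\<omega>. ennreal (s ^ card (active \<omega> A \<inter> {..<m} \<times> UNIV))) \<in> borel_measurable sample" (is ?meas)
    and "(\<integral>\<^sup>+\<omega>. ennreal (s ^ card (active \<omega> A \<inter> {..<m} \<times> UNIV)) \<partial>sample)
      = ennreal (exp (- ((\<Sum>n<m. t n * measure (\<mu> n) A) * (1 - s))))" (is ?int)
proof -
  let ?G = "\<lambda>\<omega>. ennreal (s ^ card (active \<omega> A \<inter> {..<m} \<times> UNIV))"
  \<comment> \<open>Each active point contributes a factor \<open>s\<close> if it lies in
    \<open>A\<close> and 1 otherwise, so the product counts the points in \<open>A\<close>;
    \<open>r n\<close> is the mean of \<open>g\<close> under \<open>\<mu> n\<close>.\<close>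
  define g :: "'a \<Rightarrow> ennreal" where "g x = ennreal (if x \<in> A then s else 1)" for x
  define r where "r n = 1 - measure (\<mu> n) A * (1 - s)" for n
  have g_meas [measurable]: "g \<in> borel_measurable borel" unfolding g_def by measurable
  have G: "?G \<omega> = (\<Prod>n<m. \<Prod>i<fst \<omega> n. g (snd \<omega> (n, i)))" for \<omega>
  proof -
    let ?S = "Sigma {..<m} (\<lambda>n. {..<fst \<omega> n})"
    have "(\<Prod>n<m. \<Prod>i<fst \<omega> n. g (snd \<omega> (n, i))) = (\<Prod>p\<in>?S. g (snd \<omega> p))"
      by (subst prod.Sigma) auto
    also have "\<dots> = ennreal (\<Prod>p\<in>?S. if snd \<omega> p \<in> A then s else 1)"
      unfolding g_def using s by (intro prod_ennreal) auto
    also have "(\<Prod>p\<in>?S. if snd \<omega> p \<in> A then s else 1) = s ^ card {p\<in>?S. snd \<omega> p \<in> A}"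
      by (simp add: prod.If_cases Int_def)
    also have "{p\<in>?S. snd \<omega> p \<in> A} = active \<omega> A \<inter> {..<m} \<times> UNIV"
      by (auto simp: active_def)
    finally show ?thesis ..
  qed
  show ?meas
    unfolding G
  proof (rule borel_measurable_prod_ennreal)
    fix n
    show "(\<lambda>\<omega>. \<Prod>i<fst \<omega> n. g (snd \<omega> (n, i))) \<in> borel_measurable sample"
      \<comment> \<open>The number of factors is random, so measurability is checked separately for
        each of its countably many values.\<close>
      by (rule measurable_compose_countable[where f = "\<lambda>k \<omega>. \<Prod>i<k. g (snd \<omega> (n, i))"]) measurable
  qed
  have r: "0 \<le> r n" "r n \<le> 1" for n
  proof -
    have "measure (\<mu> n) A * (1 - s) \<le> 1 * 1"
      using s prob_space.prob_le_1[OF prob_\<mu>] by (intro mult_mono) auto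
    then show "0 \<le> r n" "r n \<le> 1" using s by (auto simp: r_def)
  qed
  have g_int: "integral\<^sup>N (\<mu> n) g = ennreal (r n)" for n
  proof -
    interpret prob_space "\<mu> n" by (rule prob_\<mu>)
    have [measurable]: "A \<in> events" using A sets_\<mu> by simp
    have "integral\<^sup>N (\<mu> n) g = (\<integral>\<^sup>+x. ennreal s * indicator A x + indicator (space (\<mu> n) - A) x \<partial>\<mu> n)"
      by (intro nn_integral_cong) (auto simp: g_def split: split_indicator)
    also have "\<dots> = ennreal s * emeasure (\<mu> n) A + emeasure (\<mu> n) (space (\<mu> n) - A)"
      by (simp add: nn_integral_add nn_integral_cmult_indicator)
    also have "\<dots> = ennreal (s * prob A + (1 - prob A))"
      using s by (simp add: emeasure_eq_measure prob_compl ennreal_mult ennreal_plus)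
    also have "s * prob A + (1 - prob A) = r n"
      by (simp add: r_def algebra_simps)
    finally show ?thesis .
  qed
  interpret points: prob_space points by (rule prob_space_points)
  have inner: "(\<integral>\<^sup>+Y. ?G (N, Y) \<partial>points) = (\<Prod>n<m. ennreal (r n ^ N n))" for N
  proof -
    let ?S = "Sigma {..<m} (\<lambda>n. {..<N n})"
    have "(\<integral>\<^sup>+Y. ?G (N, Y) \<partial>points) = (\<integral>\<^sup>+Y. (\<Prod>p\<in>?S. g (Y p)) \<partial>points)"
      unfolding G by (subst prod.Sigma) auto
    also have "\<dots> = (\<Prod>p\<in>?S. integral\<^sup>N (\<mu> (fst p)) g)"
      unfolding points_def
      by (rule nn_integral_PiM_prod_finite[OF prob_\<mu>])
        (auto simp: measurable_cong_sets[OF sets_\<mu> refl])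
    also have "\<dots> = (\<Prod>n<m. \<Prod>i<N n. ennreal (r n))"
      unfolding g_int by (subst prod.Sigma) (auto intro: prod.cong)
    also have "\<dots> = (\<Prod>n<m. ennreal (r n ^ N n))"
      using r by (simp add: ennreal_power)
    finally show ?thesis .
  qed
  have "(\<integral>\<^sup>+\<omega>. ?G \<omega> \<partial>sample) = (\<integral>\<^sup>+N. \<integral>\<^sup>+Y. ?G (N, Y) \<partial>points \<partial>counts)"
    using \<open>?meas\<close> unfolding sample_def by (rule points.nn_integral_fst[symmetric])
  also have "\<dots> = (\<integral>\<^sup>+N. (\<Prod>n<m. ennreal (r n ^ N n)) \<partial>counts)"
    by (simp only: inner)
  also have "\<dots> = (\<Prod>n<m. \<integral>\<^sup>+k. ennreal (r n ^ k) \<partial>measure_pmf (poisson_law (t n)))"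
    unfolding counts_def
    by (rule nn_integral_PiM_prod_finite) (auto intro: measure_pmf.prob_space_axioms)
  also have "\<dots> = (\<Prod>n<m. ennreal (exp (- (t n * (1 - r n)))))"
    using t_nonneg r by (simp add: nn_integral_power_poisson_law)
  also have "\<dots> = ennreal (\<Prod>n<m. exp (- (t n * (1 - r n))))"
    by (intro prod_ennreal) auto
  also have "(\<Prod>n<m. exp (- (t n * (1 - r n)))) = exp (\<Sum>n<m. - (t n * (1 - r n)))"
    by (simp add: exp_sum)
  also have "(\<Sum>n<m. - (t n * (1 - r n))) = - ((\<Sum>n<m. t n * measure (\<mu> n) A) * (1 - s))"
    by (simp add: r_def sum_negf sum_distrib_right mult.assoc)
  finally show ?int .
qed

text \<open>Let the number of pieces tend to infinity in \<open>partial_pgf\<close>: the integrands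
  converge pointwise and are bounded by 1, so dominated convergence gives the Poisson generating
  function with parameter \<open>T\<close>.\<close>

lemma has_poisson_law_active:
  assumes A: "A \<in> sets borel" and T: "(\<lambda>n. t n * measure (\<mu> n) A) sums T"
  shows "has_poisson_law sample (\<lambda>\<omega>. ecard (active \<omega> A)) T"
proof (rule has_poisson_law_pgfI[OF prob_space_sample measurable_ecard_active[OF A]])
  interpret prob_space sample by (rule prob_space_sample)
  show "0 \<le> T"
    using t_nonneg by (intro sums_le[OF _ sums_zero T]) auto
  fix s :: real assume s: "0 < s" "s < 1"
  let ?G = "\<lambda>m \<omega>. ennreal (s ^ card (active \<omega> A \<inter> {..<m} \<times> UNIV))"
  let ?L = "\<lambda>\<omega>. ennreal (epower s (ecard (active \<omega> A)))"
  have lim: "(\<lambda>m. ?G m \<omega>) \<longlonglongrightarrow> ?L \<omega>" for \<omega>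
  proof (rule tendsto_ennrealI)
    have "finite (active \<omega> A \<inter> {..<m} \<times> UNIV)" for m
      by (rule finite_subset[of _ "Sigma {..<m} (\<lambda>n. {..<fst \<omega> n})"]) (auto simp: active_def)
    moreover have "incseq (\<lambda>m. active \<omega> A \<inter> {..<m} \<times> UNIV)"
      by (auto simp: incseq_def)
    moreover have "active \<omega> A = (\<Union>m. active \<omega> A \<inter> {..<m} \<times> UNIV)"
      by auto
    ultimately show "(\<lambda>m. s ^ card (active \<omega> A \<inter> {..<m} \<times> UNIV)) \<longlonglongrightarrow> epower s (ecard (active \<omega> A))"
      using power_card_LIMSEQ_epower[of s "\<lambda>m. active \<omega> A \<inter> {..<m} \<times> UNIV"] s by simp
  qed
  have "?L \<in> borel_measurable sample"
    by (rule measurable_compose[OF measurable_ecard_active[OF A]]) simp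
  then have "(\<lambda>m. \<integral>\<^sup>+\<omega>. ?G m \<omega> \<partial>sample) \<longlonglongrightarrow> (\<integral>\<^sup>+\<omega>. ?L \<omega> \<partial>sample)"
    using lim partial_pgf(1)[OF A s] s
    by (intro nn_integral_dominated_convergence[where w = "\<lambda>_. 1"])
      (auto simp: emeasure_space_1 power_le_one)
  moreover have "(\<lambda>m. \<integral>\<^sup>+\<omega>. ?G m \<omega> \<partial>sample) \<longlonglongrightarrow> ennreal (exp (- (T * (1 - s))))"
    unfolding partial_pgf(2)[OF A s]
    using T unfolding sums_def by (intro tendsto_ennrealI tendsto_intros)
  ultimately show "(\<integral>\<^sup>+\<omega>. ?L \<omega> \<partial>sample) = ennreal (exp (- (T * (1 - s))))"
    by (rule LIMSEQ_unique)
qed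

section \<open>Distinctness of the points and closedness of the support\<close>

text \<open>There are countably many pairs of indices. If the piece of \<open>p\<close> has mass 0,
  then almost surely \<open>p\<close> is inactive; otherwise its point has an atomless law and
  almost surely differs from any other point, active or not.\<close>

lemma AE_inj_on_active: "AE \<omega> in sample. inj_on (snd \<omega>) (active \<omega> UNIV)"
proof -
  interpret pair_prob_space counts points
    unfolding pair_prob_space_def pair_sigma_finite_def
    by (intro conjI prob_space_imp_sigma_finite prob_space_counts prob_space_points)
  have "AE \<omega> in sample. p \<noteq> q \<longrightarrow> snd p < fst \<omega> (fst p) \<longrightarrow> snd \<omega> p \<noteq> snd \<omega> q" for p q
  proof (cases "p = q")
    case False
    have "AE \<omega> in counts \<Otimes>\<^sub>M points. snd p < fst \<omega> (fst p) \<longrightarrow> snd \<omega> p \<noteq> snd \<omega> q"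
    proof (rule AE_pair_measure)
      show "{\<omega>\<in>space (counts \<Otimes>\<^sub>M points). snd p < fst \<omega> (fst p) \<longrightarrow> snd \<omega> p \<noteq> snd \<omega> q} \<in> sets (counts \<Otimes>\<^sub>M points)"
        unfolding sample_def[symmetric] by measurable
      show "AE N in counts. AE Y in points. snd p < fst (N, Y) (fst p) \<longrightarrow> snd (N, Y) p \<noteq> snd (N, Y) q"
      proof (cases "t (fst p) = 0")
        case True
        have "AE N in counts. N (fst p) = 0"
          unfolding counts_def
          by (rule AE_PiM_component)
            (auto simp: True poisson_law_def AE_measure_pmf_iff intro: measure_pmf.prob_space_axioms)
        then show ?thesis by eventually_elim simp
      next
        case nz: False
        then have "atomless (\<mu> (fst p))"
          using t_nonneg[of "fst p"] by (intro atomless_\<mu>) auto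
        then have "AE Y in points. Y p \<noteq> Y q"
          unfolding points_def using False by (intro AE_PiM_coordinates_neq prob_\<mu> sets_\<mu>)
        then show ?thesis by (auto elim: eventually_mono)
      qed
    qed
    then show ?thesis unfolding sample_def by (auto elim: eventually_mono)
  qed simp
  then have "AE \<omega> in sample. \<forall>p q. p \<noteq> q \<longrightarrow> snd p < fst \<omega> (fst p) \<longrightarrow> snd \<omega> p \<noteq> snd \<omega> q"
    unfolding AE_all_countable by blast
  then show ?thesis
    by eventually_elim (auto simp: inj_on_def active_def)
qed

text \<open>Closedness is local: a limit point in \<open>V k\<close> lies in the closure of
  \<open>V k \<inter> support \<omega>\<close>, which is finite and hence already closed.\<close>

lemma closed_support:
  assumes V: "\<And>k::nat. open (V k)" "(\<Union>k. V k) = UNIV" and fin: "\<And>k. finite (active \<omega> (V k))"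
  shows "closed (support \<omega>)"
proof -
  have "closure (support \<omega>) \<subseteq> support \<omega>"
  proof
    fix x assume x: "x \<in> closure (support \<omega>)"
    obtain k where k: "x \<in> V k" using V(2) by auto
    have "V k \<inter> support \<omega> = snd \<omega> ` active \<omega> (V k)"
      by (auto simp: support_def active_def)
    then have "closed (V k \<inter> support \<omega>)"
      using fin by (simp add: finite_imp_closed)
    then show "x \<in> support \<omega>"
      using open_Int_closure_subset[OF V(1), of k "support \<omega>"] x k by (auto simp: closure_closed)
  qed
  then show ?thesis by (simp add: closure_subset_eq)
qed

text \<open>Almost surely every \<open>V k\<close> contains finitely many active points and no point
  is repeated. Then taking closures changes nothing, and counting points of the set in
  \<open>U\<close> is the same as counting active indices.\<close>

lemma has_poisson_law_closure_support:
  assumes U: "open U" "(\<lambda>n. t n * measure (\<mu> n) U) sums T"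
    and V: "\<And>k::nat. open (V k)" "(\<Union>k. V k) = UNIV" "\<And>k. summable (\<lambda>n. t n * measure (\<mu> n) (V k))"
  shows "has_poisson_law (distr sample effros (\<lambda>\<omega>. closure (support \<omega>))) (\<lambda>F. ecard (F \<inter> U)) T"
proof -
  have "AE \<omega> in sample. ecard (active \<omega> (V k)) \<noteq> \<infinity>" for k
    using V by (intro has_poisson_law_AE_finite[OF has_poisson_law_active] summable_sums) auto
  then have "AE \<omega> in sample. \<forall>k. ecard (active \<omega> (V k)) \<noteq> \<infinity>"
    by (simp add: AE_all_countable)
  then have eq: "AE \<omega> in sample. ecard (closure (support \<omega>) \<inter> U) = ecard (active \<omega> U)"
    using AE_inj_on_active
  proof eventually_elim
    case (elim \<omega>)
    have "finite (active \<omega> (V k))" for k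
      using elim(1) by (auto simp: ecard_def split: if_splits)
    then have "closure (support \<omega>) = support \<omega>"
      by (intro closure_closed closed_support[OF V(1,2)])
    moreover have "support \<omega> \<inter> U = snd \<omega> ` active \<omega> U"
      by (auto simp: support_def active_def)
    moreover have "inj_on (snd \<omega>) (active \<omega> U)"
      by (rule inj_on_subset[OF elim(2)]) (auto simp: active_def)
    ultimately show ?case
      by (simp add: ecard_def card_image finite_image_iff)
  qed
  note 1 = measurable_ecard_effros[OF U(1)]
  have U': "U \<in> sets borel" using U(1) by simp
  have "distr (distr sample effros (\<lambda>\<omega>. closure (support \<omega>))) (count_space UNIV) (\<lambda>F. ecard (F \<inter> U))
      = distr sample (count_space UNIV) (\<lambda>\<omega>. ecard (closure (support \<omega>) \<inter> U))"
    using distr_distr[OF 1 measurable_closure_support] by (simp add: comp_def)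
  also have "\<dots> = distr sample (count_space UNIV) (\<lambda>\<omega>. ecard (active \<omega> U))"
    using eq measurable_ecard_active[OF U'] measurable_compose[OF measurable_closure_support 1]
    by (intro distr_cong_AE) auto
  also have "\<dots> = measure_pmf (map_pmf enat (poisson_law T))"
    using has_poisson_law_active[OF U' U(2)] by (simp add: has_poisson_law_def)
  finally show ?thesis
    using 1 unfolding has_poisson_law_def by simp
qed

end

section \<open>Existence of the Poisson process\<close>

lemma ex_poisson_process:
  fixes M :: "'a::polish_space measure"
  assumes M: "sets M = sets borel" "locally_finite M" "atomless M"
  obtains P :: "'a set measure" where "prob_space P" "sets P = sets effros"
    "\<And>U. open U \<Longrightarrow> emeasure M U < \<infinity> \<Longrightarrow>
      has_poisson_law P (\<lambda>F. ecard (F \<inter> U)) (measure M U)"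
proof -
  obtain V :: "nat \<Rightarrow> 'a set" where V: "\<And>n. open (V n)" "\<And>n. emeasure M (V n) < \<infinity>" "(\<Union>n. V n) = UNIV"
    using locally_finite_countable_cover[OF M(2)] by blast
  define B where "B = disjointed V"
  have V_sets: "V n \<in> sets M" for n using V(1) M(1) by simp
  have B_sets: "B n \<in> sets M" for n
    using sets.range_disjointed_sets[of V M] V_sets unfolding B_def by auto
  have B_disj: "disjoint_family B" unfolding B_def by (rule disjoint_family_disjointed)
  have B_UN: "(\<Union>n. B n) = UNIV" unfolding B_def using V(3) by (simp add: UN_disjointed_eq)
  have B_fin: "emeasure M (B n) < \<infinity>" for n
  proof -
    have "emeasure M (B n) \<le> emeasure M (V n)"
      unfolding B_def by (intro emeasure_mono disjointed_subset V_sets)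
    also note V(2)
    finally show ?thesis .
  qed
  define t where "t n = measure M (B n)" for n
  \<comment> \<open>On a null piece normalisation is impossible; the Dirac measure is a placeholder
    there, and its Poisson count is 0.\<close>
  define \<mu> where "\<mu> n = (if t n = 0 then return borel undefined else uniform_measure M (B n))" for n
  have em: "emeasure M (B n) = ennreal (t n)" for n
    unfolding t_def using B_fin[of n] by (intro emeasure_eq_ennreal_measure) auto
  interpret poisson_superposition t \<mu>
  proof (rule poisson_superposition.intro)
    fix n
    show "0 \<le> t n" by (simp add: t_def)
    show "prob_space (\<mu> n)"
      unfolding \<mu>_def using em[of n] by (auto intro!: prob_space_return prob_space_uniform_measure simp: t_def)
    show "sets (\<mu> n) = sets borel" by (simp add: \<mu>_def M(1))
    show "atomless (\<mu> n)" if "0 < t n"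
      unfolding atomless_def
    proof
      fix x
      have "emeasure M (B n \<inter> {x}) \<le> emeasure M {x}"
        using M(1) by (intro emeasure_mono) auto
      then have "emeasure M (B n \<inter> {x}) = 0"
        using M(3) by (simp add: atomless_def)
      then show "emeasure (\<mu> n) {x} = 0"
        using that B_sets[of n] M(1) by (simp add: \<mu>_def)
    qed
  qed
  \<comment> \<open>Each term equals the measure of \<open>B n \<inter> U\<close>, so the
    intensities add up by countable additivity over the partition.\<close>
  have mass: "(\<lambda>n. t n * measure (\<mu> n) U) sums measure M U" if U: "open U" "emeasure M U < \<infinity>" for U
  proof -
    have U_sets: "U \<in> sets M" using U M(1) by simp
    have "emeasure M (B n \<inter> U) = ennreal (t n * measure (\<mu> n) U)" for n
    proof (cases "t n = 0")
      case True
      then have "emeasure M (B n \<inter> U) \<le> 0"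
        using emeasure_mono[OF Int_lower1 B_sets, of n U] em[of n] by simp
      then show ?thesis using True by simp
    next
      case False
      then have "measure (\<mu> n) U = measure M (B n \<inter> U) / t n"
        using measure_uniform_measure[of M "B n" U] em[of n] U_sets by (simp add: \<mu>_def t_def)
      moreover have "emeasure M (B n \<inter> U) \<noteq> \<infinity>"
        using emeasure_mono[OF Int_lower1 B_sets, of n U] B_fin[of n] by (auto simp: top_unique)
      ultimately show ?thesis
        using False by (simp add: emeasure_eq_ennreal_measure)
    qed
    moreover have "(\<lambda>n. emeasure M (B n \<inter> U)) sums emeasure M (\<Union>n. B n \<inter> U)"
      using B_disj B_sets U_sets by (intro sums_emeasure) (auto simp: disjoint_family_on_def)
    moreover have "(\<Union>n. B n \<inter> U) = U" using B_UN by auto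
    moreover have "emeasure M U = ennreal (measure M U)"
      using U(2) by (intro emeasure_eq_ennreal_measure) auto
    ultimately have "(\<lambda>n. ennreal (t n * measure (\<mu> n) U)) sums ennreal (measure M U)"
      by simp
    then show ?thesis
      using t_nonneg by (subst (asm) sums_ennreal) auto
  qed
  show ?thesis
  proof
    show "prob_space (distr sample effros (\<lambda>\<omega>. closure (support \<omega>)))"
      by (rule prob_space.prob_space_distr[OF prob_space_sample measurable_closure_support])
    show "has_poisson_law (distr sample effros (\<lambda>\<omega>. closure (support \<omega>))) (\<lambda>F. ecard (F \<inter> U)) (measure M U)"
      if "open U" "emeasure M U < \<infinity>" for U
      using that mass V by (intro has_poisson_law_closure_support[where V = V] sums_summable) auto
  qed simp
qed

theorem theorem6p3:
  fixes M :: "'a::polish_space measure"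
  assumes "sets M = sets borel"
    and "locally_finite M"
    and "atomless M"
  shows "\<exists>!P :: 'a set measure.
           prob_space P \<and> sets P = sets effros \<and>
           (\<forall>U. open U \<and> emeasure M U < \<infinity> \<longrightarrow>
              has_poisson_law P (\<lambda>F. ecard (F \<inter> U)) (measure M U))"
proof (rule ex_ex1I)
  show "\<exists>P :: 'a set measure. prob_space P \<and> sets P = sets effros \<and>
           (\<forall>U. open U \<and> emeasure M U < \<infinity> \<longrightarrow>
              has_poisson_law P (\<lambda>F. ecard (F \<inter> U)) (measure M U))"
    using ex_poisson_process[OF assms] by metis
next
  fix P Q :: "'a set measure"
  assume P: "prob_space P \<and> sets P = sets effros \<and>
           (\<forall>U. open U \<and> emeasure M U < \<infinity> \<longrightarrow>
              has_poisson_law P (\<lambda>F. ecard (F \<inter> U)) (measure M U))"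
    and Q: "prob_space Q \<and> sets Q = sets effros \<and>
           (\<forall>U. open U \<and> emeasure M U < \<infinity> \<longrightarrow>
              has_poisson_law Q (\<lambda>F. ecard (F \<inter> U)) (measure M U))"
  \<comment> \<open>The count in \<open>U\<close> is 0 exactly on the void event of
    \<open>U\<close>, so both candidate laws assign it the same probability.\<close>
  have void: "emeasure R {F. closed F \<and> F \<inter> U = {}} = ennreal (exp (- measure M U))"
    if "sets R = sets effros" "has_poisson_law R (\<lambda>F. ecard (F \<inter> U)) (measure M U)"
    for R :: "'a set measure" and U
    using has_poisson_law_void[OF that(2)] sets_eq_imp_space_eq[OF that(1)] by simp
  show "P = Q"
    using P Q void by (intro effros_measure_eqI[OF assms(1,2)]) auto
qed

end
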